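(* Let $q\geq 2$ be an integer and let $\mathcal{A}$ be an affine plane of order $q$. Let $\mathcal{L}$ be a set of $q+1$ pairwise non-parallel lines of $\mathcal{A}$ and let $\mathcal{K}$ be the Kakeya set determined by $\mathcal{L}$. Put $\kappa=\sqrt{q+\tfrac14}-\tfrac12$. If $$|\mathcal{K}|> q^2-\min\left\{\lceil\kappa\rceil\left(q-\lceil\kappa\rceil\right),\ \frac{q\left(q-\lfloor\kappa\rfloor\right)}{\lfloor\kappa\rfloor+1}\right\},$$ then $\mathcal{K}$ contains a $(q+1-k)$-knot for some integer $k$ with $0\leq k<\lceil\kappa\rceil$, and $$|\mathcal{K}|\in\left[q^2-kq+\frac{k(k+1)}{2},\ q^2-kq+k^2\right].$$
   Context: An affine plane of order $q$ is a set of $q^2$ points and $q^2+q$ lines (each line a set of $q$ points) such that any two points lie on exactly one line and any two lines meet in at most one point; its lines are partitioned into $q+1$ parallel classes, each consisting of $q$ pairwise disjoint lines. A Kakeya set is the set $\mathcal{K}$ of points covered by a set $\mathcal{L}$ of $q+1$ lines containing exactly one line from each parallel class (equivalently, $q+1$ pairwise non-parallel lines). For an integer $j$, a $j$-knot of $\mathcal{K}$ is a point lying on exactly $j$ lines of $\mathcal{L}$. *)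

theory Defs
  imports Complex_Main
begin

locale affine_plane =
  fixes q :: nat and Points :: "'a set" and Lines :: "'a set set"
  assumes card_Points: "card Points = q^2"
    and card_Lines: "card Lines = q^2 + q"
    and line_subset: "l \<in> Lines \<Longrightarrow> l \<subseteq> Points"
    and card_line: "l \<in> Lines \<Longrightarrow> card l = q"
    and unique_line:
      "\<lbrakk>x \<in> Points; y \<in> Points; x \<noteq> y\<rbrakk> \<Longrightarrow> \<exists>!l. l \<in> Lines \<and> x \<in> l \<and> y \<in> l"
    and lines_meet:
      "\<lbrakk>l \<in> Lines; m \<in> Lines; l \<noteq> m; x \<in> l \<inter> m; y \<in> l \<inter> m\<rbrakk> \<Longrightarrow> x = y"

definition parallel :: "'a set \<Rightarrow> 'a set \<Rightarrow> bool" where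
  "parallel l m \<longleftrightarrow> l = m \<or> l \<inter> m = {}"

definition Kakeya_set :: "'a set set \<Rightarrow> 'a set" where
  "Kakeya_set L = \<Union>L"

text \<open>Knots are taken relative to the chosen lines \<open>L\<close>, not merely to the point set they cover.\<close>

definition knot :: "'a set set \<Rightarrow> int \<Rightarrow> 'a \<Rightarrow> bool" where
  "knot L j x \<longleftrightarrow> x \<in> Kakeya_set L \<and> int (card {l \<in> L. x \<in> l}) = j"

end

theory Submission
  imports Defs
begin

text \<open>Let \<open>a x\<close> be the number of lines of \<open>L\<close> through \<open>x\<close>. Counting incidences and pairs of
  lines gives \<open>\<Sum>(a x - 1)\<^sup>2 = |K|\<close> and \<open>\<Sum>(a x - 1) = q\<^sup>2 + q - |K|\<close>, both sums over \<open>K\<close>, so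
  that \<open>|K| \<le> f (q\<^sup>2 + q - |K|)\<close> if no point has multiplicity above \<open>f + 1\<close>. For \<open>f = \<lfloor>\<kappa>\<rfloor>\<close> the
  hypothesis excludes this, and there is a \<open>(q + 1 - k)\<close>-knot with \<open>k \<le> q - \<lceil>\<kappa>\<rceil>\<close>. The pencil of
  any \<open>(q + 1 - k)\<close>-knot leaves exactly \<open>k - 1\<close> points uncovered on each of the other \<open>k\<close>
  lines; these points are at most \<open>k (k - 1)\<close> in number, and at least \<open>k (k - 1) / 2\<close> since two
  lines share at most one of them. This yields the interval for \<open>|K|\<close>, whose upper end,
  compared with \<open>q\<^sup>2 - \<lceil>\<kappa>\<rceil> (q - \<lceil>\<kappa>\<rceil>)\<close>, forces \<open>k < \<lceil>\<kappa>\<rceil>\<close>.\<close>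

text \<open>Adding the sets one at a time, the set added after \<open>s\<close> others meets their
  union in at most \<open>s\<close> points and so brings at least \<open>n - s\<close> new ones. The
  total is doubled and taken over \<open>int\<close> to avoid halving and truncated
  subtraction.\<close>

lemma card_UN_almost_disjoint:
  assumes "finite S" "\<And>i. i \<in> S \<Longrightarrow> finite (A i)" "\<And>i. i \<in> S \<Longrightarrow> card (A i) = n"
    and "\<And>i j. i \<in> S \<Longrightarrow> j \<in> S \<Longrightarrow> i \<noteq> j \<Longrightarrow> card (A i \<inter> A j) \<le> 1"
  shows "int (card S) * (2 * int n + 1 - int (card S)) \<le> 2 * int (card (\<Union>i\<in>S. A i))"
  using assms
proof (induction S rule: finite_induct)
  case empty
  then show ?case by simp
next
  case (insert i S)
  let ?B = "\<Union>j\<in>S. A j"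
  have fin: "finite (A i)" "finite ?B"
    using insert by auto
  have IH: "int (card S) * (2 * int n + 1 - int (card S)) \<le> 2 * int (card ?B)"
    using insert by simp
  have "card (A i \<inter> ?B) = card (\<Union>j\<in>S. A i \<inter> A j)"
    by (rule arg_cong[where f = card]) blast
  also have "\<dots> \<le> (\<Sum>j\<in>S. card (A i \<inter> A j))"
    using insert.hyps by (intro card_UN_le)
  also have "\<dots> \<le> (\<Sum>j\<in>S. 1)"
    using insert by (intro sum_mono) auto
  finally have "int (card (A i \<inter> ?B)) \<le> int (card S)"
    by simp
  moreover have "card (A i) + card ?B = card (A i \<union> ?B) + card (A i \<inter> ?B)"
    using card_Un_Int[OF fin] .
  then have "int n + int (card ?B) = int (card (A i \<union> ?B)) + int (card (A i \<inter> ?B))"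
    using insert.prems(2)[of i] by (simp flip: of_nat_add)
  ultimately have "int n + int (card ?B) - int (card S) \<le> int (card (A i \<union> ?B))"
    by linarith
  then show ?case
    using IH insert.hyps by (simp add: algebra_simps)
qed

text \<open>Isolates the incidence data behind all the counting: non-parallel lines of an affine
  plane meet in exactly one point.\<close>

locale meeting_lines =
  fixes q :: nat and L :: "'a set set"
  assumes q_pos: "q > 0"
    and card_L: "card L = q + 1"
    and card_line: "l \<in> L \<Longrightarrow> card l = q"
    and card_meet: "l \<in> L \<Longrightarrow> m \<in> L \<Longrightarrow> l \<noteq> m \<Longrightarrow> card (l \<inter> m) = 1"
begin

lemma finite_L: "finite L"
  using card_L by (simp add: card_ge_0_finite)

lemma finite_line: "l \<in> L \<Longrightarrow> finite l"
  using card_line q_pos by (simp add: card_ge_0_finite)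

lemma finite_Kakeya: "finite (Kakeya_set L)"
  unfolding Kakeya_set_def using finite_L finite_line by blast

section \<open>Moments of the multiplicity\<close>

definition mult :: "'a \<Rightarrow> nat" where
  "mult x = card {l \<in> L. x \<in> l}"

lemma mult_eq_sum: "mult x = (\<Sum>l\<in>L. if x \<in> l then 1 else 0)"
  unfolding mult_def using finite_L by (simp add: sum.If_cases Int_def)

lemma mult_pos: "x \<in> Kakeya_set L \<Longrightarrow> mult x \<ge> 1"
  unfolding mult_def Kakeya_set_def using finite_L
  by (auto simp: Suc_le_eq card_gt_0_iff)

lemma card_subset_Kakeya:
  assumes "A \<subseteq> Kakeya_set L"
  shows "(\<Sum>x\<in>Kakeya_set L. if x \<in> A then 1 else 0) = card A"
  using assms finite_Kakeya by (simp add: sum.If_cases Int_absorb1)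

lemma sum_mult: "(\<Sum>x\<in>Kakeya_set L. mult x) = q * (q + 1)"
proof -
  have "(\<Sum>x\<in>Kakeya_set L. mult x) = (\<Sum>l\<in>L. \<Sum>x\<in>Kakeya_set L. if x \<in> l then 1 else 0)"
    unfolding mult_eq_sum by (rule sum.swap)
  also have "\<dots> = (\<Sum>l\<in>L. q)"
    by (intro sum.cong refl, subst card_subset_Kakeya) (auto simp: Kakeya_set_def card_line)
  finally show ?thesis
    using card_L by simp
qed

text \<open>Counts triples of a point and an ordered pair of lines through it: each \<open>l\<close>
  contributes \<open>q\<close> for \<open>m = l\<close> and 1 for each of the \<open>q\<close> other
  lines.\<close>

lemma sum_mult_sq: "(\<Sum>x\<in>Kakeya_set L. mult x * mult x) = 2 * (q * (q + 1))"
proof -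
  have "(\<Sum>x\<in>Kakeya_set L. mult x * mult x)
      = (\<Sum>x\<in>Kakeya_set L. \<Sum>l\<in>L. \<Sum>m\<in>L. if x \<in> l \<inter> m then 1 else 0)"
    unfolding mult_eq_sum sum_product by (intro sum.cong refl) auto
  also have "\<dots> = (\<Sum>l\<in>L. \<Sum>x\<in>Kakeya_set L. \<Sum>m\<in>L. if x \<in> l \<inter> m then 1 else 0)"
    by (rule sum.swap)
  also have "\<dots> = (\<Sum>l\<in>L. \<Sum>m\<in>L. \<Sum>x\<in>Kakeya_set L. if x \<in> l \<inter> m then 1 else 0)"
    by (intro sum.cong refl sum.swap)
  also have "\<dots> = (\<Sum>l\<in>L. \<Sum>m\<in>L. card (l \<inter> m))"
    by (intro sum.cong refl card_subset_Kakeya) (auto simp: Kakeya_set_def)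
  also have "\<dots> = (\<Sum>l\<in>L. q + q)"
  proof (intro sum.cong refl)
    fix l assume l: "l \<in> L"
    have "(\<Sum>m\<in>L. card (l \<inter> m)) = card l + (\<Sum>m\<in>L - {l}. card (l \<inter> m))"
      using sum.remove[OF finite_L l, of "\<lambda>m. card (l \<inter> m)"] by simp
    also have "(\<Sum>m\<in>L - {l}. card (l \<inter> m)) = (\<Sum>m\<in>L - {l}. 1)"
      using l card_meet by (intro sum.cong) auto
    also have "\<dots> = q"
      using l card_L finite_L by simp
    finally show "(\<Sum>m\<in>L. card (l \<inter> m)) = q + q"
      using card_line[OF l] by simp
  qed
  finally show ?thesis
    using card_L by simp
qed

lemma card_Kakeya_le_of_mult_le:
  fixes f :: int
  assumes "\<And>x. x \<in> Kakeya_set L \<Longrightarrow> int (mult x) \<le> f + 1"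
  shows "int (card (Kakeya_set L)) \<le> f * ((int q)^2 + int q - int (card (Kakeya_set L)))"
proof -
  let ?K = "Kakeya_set L"
  have 1: "(\<Sum>x\<in>?K. int (mult x)) = int q * (int q + 1)"
    using arg_cong[OF sum_mult, of int] by (simp add: algebra_simps)
  have 2: "(\<Sum>x\<in>?K. int (mult x) * int (mult x)) = 2 * (int q * (int q + 1))"
    using arg_cong[OF sum_mult_sq, of int] by (simp add: algebra_simps)
  \<comment> \<open>The second moment is exactly twice the first, so both cancel and only the count
    of points remains.\<close>
  have "(\<Sum>x\<in>?K. (int (mult x) - 1) * (int (mult x) - 1))
      = (\<Sum>x\<in>?K. int (mult x) * int (mult x)) - 2 * (\<Sum>x\<in>?K. int (mult x)) + int (card ?K)"
    by (simp add: algebra_simps sum.distrib sum_subtractf sum_distrib_left)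
  also have "\<dots> = int (card ?K)"
    using 1 2 by simp
  finally have "int (card ?K) = (\<Sum>x\<in>?K. (int (mult x) - 1) * (int (mult x) - 1))" ..
  also have "\<dots> \<le> (\<Sum>x\<in>?K. f * (int (mult x) - 1))"
    using assms mult_pos by (intro sum_mono mult_right_mono) force+
  also have "\<dots> = f * ((\<Sum>x\<in>?K. int (mult x)) - int (card ?K))"
    by (simp add: sum_subtractf flip: sum_distrib_left)
  finally show ?thesis
    using 1 by (simp add: algebra_simps power2_eq_square)
qed

section \<open>The pencil through a point\<close>

lemma meet_unique:
  assumes "l \<in> L" "m \<in> L" "l \<noteq> m" "x \<in> l" "x \<in> m" "y \<in> l" "y \<in> m"
  shows "x = y"
proof -
  have "card (l \<inter> m) = 1"
    using assms by (intro card_meet)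
  then obtain z where "l \<inter> m = {z}"
    by (auto simp: card_1_singleton_iff)
  then have "x = z" "y = z"
    using assms by (metis IntI singletonD)+
  then show ?thesis by simp
qed

text \<open>The lines of the pencil are pairwise disjoint away from \<open>x\<close>, and each adds
  \<open>q - 1\<close> points to it.\<close>

lemma card_pencil:
  assumes "x \<in> Kakeya_set L"
  shows "card (\<Union>{l \<in> L. x \<in> l}) = 1 + mult x * (q - 1)"
proof -
  let ?P = "{l \<in> L. x \<in> l}"
  have P: "finite ?P" "?P \<noteq> {}"
    using finite_L assms by (auto simp: Kakeya_set_def)
  have "\<Union>?P = insert x (\<Union>l\<in>?P. l - {x})"
    using P by auto
  moreover have "x \<notin> (\<Union>l\<in>?P. l - {x})"
    by blast
  moreover have "finite (\<Union>l\<in>?P. l - {x})"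
    using P finite_line by blast
  ultimately have "card (\<Union>?P) = 1 + card (\<Union>l\<in>?P. l - {x})"
    by (metis card_insert_disjoint plus_1_eq_Suc)
  also have "card (\<Union>l\<in>?P. l - {x}) = (\<Sum>l\<in>?P. card (l - {x}))"
  proof (intro card_UN_disjoint ballI impI)
    fix l m assume lm: "l \<in> ?P" "m \<in> ?P" "l \<noteq> m"
    then have "y = x" if "y \<in> l" "y \<in> m" for y
      using that meet_unique[of l m y x] by simp
    then show "(l - {x}) \<inter> (m - {x}) = {}" by blast
  qed (use P finite_line in auto)
  also have "(\<Sum>l\<in>?P. card (l - {x})) = (\<Sum>l\<in>?P. q - 1)"
    using card_line finite_line by (intro sum.cong) auto
  finally show ?thesis
    by (simp add: mult_def)
qed

text \<open>The line \<open>m\<close> meets each line of the pencil once, and at different points: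
  two of these lines share only \<open>x\<close>, which is off \<open>m\<close>.\<close>

lemma card_line_Int_pencil:
  assumes "m \<in> L" "x \<notin> m"
  shows "card (m \<inter> \<Union>{l \<in> L. x \<in> l}) = mult x"
proof -
  let ?P = "{l \<in> L. x \<in> l}"
  have "card (m \<inter> \<Union>?P) = card (\<Union>l\<in>?P. m \<inter> l)"
    by (rule arg_cong[where f = card]) blast
  also have "\<dots> = (\<Sum>l\<in>?P. card (m \<inter> l))"
  proof (intro card_UN_disjoint ballI impI)
    fix l l' assume l: "l \<in> ?P" "l' \<in> ?P" "l \<noteq> l'"
    show "m \<inter> l \<inter> (m \<inter> l') = {}"
    proof (rule ccontr)
      assume "m \<inter> l \<inter> (m \<inter> l') \<noteq> {}"
      then obtain y where "y \<in> m" "y \<in> l" "y \<in> l'" by blast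
      moreover from this have "x = y"
        using l meet_unique[of l l'] by blast
      ultimately show False using assms by simp
    qed
  qed (use assms finite_L finite_line in auto)
  also have "\<dots> = (\<Sum>l\<in>?P. 1)"
    using assms card_meet by (intro sum.cong) auto
  finally show ?thesis
    by (simp add: mult_def)
qed

lemma card_Kakeya_bounds:
  fixes k :: int
  assumes x: "x \<in> Kakeya_set L" and k: "int (mult x) = int q + 1 - k"
  shows "2 * ((int q)^2 - k * int q) + k * (k + 1) \<le> 2 * int (card (Kakeya_set L))"
    and "int (card (Kakeya_set L)) \<le> (int q)^2 - k * int q + k^2"
proof -
  define P where "P = {l \<in> L. x \<in> l}"
  define R where "R = L - P"
  define U where "U = \<Union>P"
  have R: "finite R" "l \<in> L" "x \<notin> l" if "l \<in> R" for l
    using that finite_L by (auto simp: R_def P_def)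
  have fin: "finite R" "finite U" "finite (\<Union>l\<in>R. l - U)"
    using finite_L finite_line by (auto simp: R_def P_def U_def)
  have "P \<subseteq> L"
    by (auto simp: P_def)
  then have "card L = card P + card R"
    unfolding R_def using finite_L
    by (metis card_Diff_subset card_mono finite_subset le_add_diff_inverse)
  then have card_R: "int (card R) = k"
    using k card_L by (simp add: P_def mult_def)
  have card_U: "int (card U) = (int q)^2 - k * int q + k"
  proof -
    have "int (card U) = 1 + int (mult x) * (int q - 1)"
      using card_pencil[OF x] q_pos by (simp add: U_def P_def of_nat_diff)
    then show ?thesis
      by (simp add: k algebra_simps power2_eq_square)
  qed
  define n where "n = q - mult x"
  have rest: "card (l - U) = n" if "l \<in> R" for l
    using card_line_Int_pencil[of l x] R[OF that] card_line finite_line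
    by (simp add: card_Diff_subset_Int n_def U_def P_def)
  \<comment> \<open>For \<open>k > 0\<close>, \<open>n\<close> is \<open>k - 1\<close>. For
    \<open>k = 0\<close> the subtraction truncates to 0, not -1, but \<open>R\<close> is then empty;
    multiplying by \<open>k\<close> covers both cases.\<close>
  have n: "k * int n = k * (k - 1)"
  proof (cases "R = {}")
    case True
    then show ?thesis using card_R by simp
  next
    case False
    then have "int (card R) > 0"
      using fin by (simp add: card_gt_0_iff)
    then show ?thesis
      using k card_R by (simp add: n_def of_nat_diff)
  qed
  have "Kakeya_set L = U \<union> (\<Union>l\<in>R. l - U)"
    using \<open>P \<subseteq> L\<close> by (auto simp: Kakeya_set_def U_def R_def)
  then have "card (Kakeya_set L) = card U + card (\<Union>l\<in>R. l - U)"
    using fin by (subst card_Un_disjoint[symmetric]) auto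
  then have K: "int (card (Kakeya_set L)) = (int q)^2 - k * int q + k + int (card (\<Union>l\<in>R. l - U))"
    using card_U by simp
  have "int (card R) * (2 * int n + 1 - int (card R)) \<le> 2 * int (card (\<Union>l\<in>R. l - U))"
  proof (rule card_UN_almost_disjoint)
    fix l m assume lm: "l \<in> R" "m \<in> R" "l \<noteq> m"
    have "card ((l - U) \<inter> (m - U)) \<le> card (l \<inter> m)"
      using lm R finite_line by (intro card_mono) auto
    then show "card ((l - U) \<inter> (m - U)) \<le> 1"
      using lm R card_meet by simp
  qed (use fin rest R finite_line in auto)
  then show "2 * ((int q)^2 - k * int q) + k * (k + 1) \<le> 2 * int (card (Kakeya_set L))"
    using K card_R n by (simp add: algebra_simps)
  have "card (\<Union>l\<in>R. l - U) \<le> (\<Sum>l\<in>R. card (l - U))"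
    using fin by (intro card_UN_le)
  also have "\<dots> = card R * n"
    using rest by simp
  finally have "int (card (\<Union>l\<in>R. l - U)) \<le> k * int n"
    using card_R by (metis of_nat_le_iff of_nat_mult)
  then show "int (card (Kakeya_set L)) \<le> (int q)^2 - k * int q + k^2"
    using K n by (simp add: algebra_simps power2_eq_square)
qed

end

theorem theorem2p3:
  fixes q :: nat and Points :: "'a set" and Lines L :: "'a set set" and \<kappa> :: real
  assumes "q \<ge> 2"
    and "affine_plane q Points Lines"
    and "L \<subseteq> Lines"
    and "card L = q + 1"
    and "\<forall>l\<in>L. \<forall>m\<in>L. l \<noteq> m \<longrightarrow> \<not> parallel l m"
    and "\<kappa> = sqrt (real q + 1/4) - 1/2"
    and "real (card (Kakeya_set L)) >
           (real q)^2 - min (of_int \<lceil>\<kappa>\<rceil> * (real q - of_int \<lceil>\<kappa>\<rceil>))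
                            (real q * (real q - of_int \<lfloor>\<kappa>\<rfloor>) / (of_int \<lfloor>\<kappa>\<rfloor> + 1))"
  shows "\<exists>k::int. 0 \<le> k \<and> k < \<lceil>\<kappa>\<rceil> \<and>
           (\<exists>x. knot L (int q + 1 - k) x) \<and>
           real (card (Kakeya_set L)) \<in>
             {(real q)^2 - of_int k * real q + of_int k * (of_int k + 1) / 2 ..
              (real q)^2 - of_int k * real q + (of_int k)^2}"
proof -
  interpret affine_plane q Points Lines by fact
  interpret M: meeting_lines q L
  proof
    fix l m assume lm: "l \<in> L" "m \<in> L" "l \<noteq> m"
    then have "l \<inter> m \<noteq> {}"
      using assms(5) by (auto simp: parallel_def)
    then obtain x where "x \<in> l \<inter> m" by blast
    moreover have "y = x" if "y \<in> l \<inter> m" for y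
      using lines_meet[of l m y x] lm assms(3) that \<open>x \<in> l \<inter> m\<close> by blast
    ultimately have "l \<inter> m = {x}" by blast
    then show "card (l \<inter> m) = 1" by simp
  qed (use assms card_line in auto)
  define N where "N = int (card (Kakeya_set L))"
  define c f where "c = \<lceil>\<kappa>\<rceil>" and "f = \<lfloor>\<kappa>\<rfloor>"
  \<comment> \<open>Nonnegativity of \<open>\<kappa>\<close> makes the denominator
    \<open>f + 1\<close> positive.\<close>
  have "sqrt (1/4) \<le> sqrt (real q + 1/4)"
    by (rule real_sqrt_le_mono) simp
  then have "\<kappa> \<ge> 0"
    using assms(6) by (simp add: real_sqrt_divide)
  then have f: "f \<ge> 0" and cf: "c \<le> f + 1"
    by (auto simp: f_def c_def) linarith
  have "real_of_int ((int q)^2 - c * (int q - c)) < real_of_int N"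
    using assms(7) by (simp add: N_def c_def)
  then have Nc: "(int q)^2 - c * (int q - c) < N"
    by linarith
  have "(real q)^2 - real_of_int N < real q * (real q - f) / (f + 1)"
    using assms(7) by (simp add: N_def f_def)
  then have "((real q)^2 - real_of_int N) * (f + 1) < real q * (real q - f)"
    using f by (simp add: pos_less_divide_eq)
  then have "real_of_int (((int q)^2 - N) * (f + 1)) < real_of_int (int q * (int q - f))"
    by simp
  then have Nf: "((int q)^2 - N) * (f + 1) < int q * (int q - f)"
    by linarith
  have "\<exists>x\<in>Kakeya_set L. int (M.mult x) > f + 1"
  proof (rule ccontr)
    assume "\<not> ?thesis"
    \<comment> \<open>This rearranges to \<open>q * (q - f) \<le> (q^2 - N) * (f + 1)\<close>, the
      negation of \<open>Nf\<close>.\<close>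
    then have "N \<le> f * ((int q)^2 + int q - N)"
      unfolding N_def by (intro M.card_Kakeya_le_of_mult_le) force
    then show False
      using Nf by (simp add: algebra_simps power2_eq_square)
  qed
  then obtain x where x: "x \<in> Kakeya_set L" "int (M.mult x) > f + 1" by blast
  define k where "k = int q + 1 - int (M.mult x)"
  have "M.mult x \<le> card L"
    unfolding M.mult_def using M.finite_L by (intro card_mono) auto
  then have k0: "0 \<le> k"
    using assms(4) by (simp add: k_def)
  \<comment> \<open>By integrality the multiplicity is at least \<open>f + 2\<close>, hence at least
    \<open>c + 1\<close>.\<close>
  have kc: "k \<le> int q - c"
    using x cf by (simp add: k_def)
  have bounds: "2 * ((int q)^2 - k * int q) + k * (k + 1) \<le> 2 * N"
    "N \<le> (int q)^2 - k * int q + k^2"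
    unfolding N_def using M.card_Kakeya_bounds[OF x(1), of k] by (simp_all add: k_def)
  have "k < c"
  proof (rule ccontr)
    assume "\<not> k < c"
    \<comment> \<open>The product equals \<open>k * (q - k) - c * (q - c)\<close>, so the upper
      bound for \<open>N\<close> would be at most \<open>q^2 - c * (q - c)\<close>, against
      \<open>Nc\<close>.\<close>
    with kc have "0 \<le> (k - c) * (int q - c - k)"
      by simp
    then show False
      using bounds(2) Nc by (simp add: algebra_simps power2_eq_square)
  qed
  moreover have "knot L (int q + 1 - k) x"
    using x by (simp add: knot_def k_def M.mult_def)
  moreover have "(real q)^2 - of_int k * real q + of_int k * (of_int k + 1) / 2 \<le> real_of_int N"
  proof -
    have "real_of_int (2 * ((int q)^2 - k * int q) + k * (k + 1)) \<le> real_of_int (2 * N)"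
      using bounds(1) by linarith
    then show ?thesis by simp
  qed
  moreover have "real_of_int N \<le> (real q)^2 - of_int k * real q + (of_int k)^2"
  proof -
    have "real_of_int N \<le> real_of_int ((int q)^2 - k * int q + k^2)"
      using bounds(2) by linarith
    then show ?thesis by simp
  qed
  ultimately show ?thesis
    using k0 unfolding N_def c_def by auto
qed

end
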